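(* Let $G$ be a finite simple graph with a $C_3$-free vertex $x$, and let $X=N_G[x]$, so that the induced subgraph on $X$ is a star $K_{1,m}$ with center $x$ and $m\ge 1$. Let $\pi:V(G)\to V(G')$ be a bijection such that: (i) $\pi(v)=v'$ for every $v\in V(G)\setminus X$; (ii) $\pi(v)\neq v'$ for every $v\in X$; (iii) if $m\ge 2$, then for all $u,v\in X$, $\pi(v)=u'$ implies $\pi(u)\neq v'$. Then no separable $\gamma$-set of $G$ is effective under $\pi$.
   Context: For a graph $G$, a set $D\subseteq V(G)$ is dominating if every vertex not in $D$ has a neighbor in $D$; $\gamma(G)$ is the minimum size of a dominating set, and a $\gamma$-set is a dominating set of size $\gamma(G)$. For sets $D,S$ write $D\succ S$ if every vertex of $S$ has a neighbor in $D$. Let $G'$ be a disjoint copy of $G$, the copy of $v\in V(G)$ being denoted $v'$ and $A'=\{v':v\in A\}$. A $\gamma$-set $A$ of $G$ is separable (an $A_1$-$\gamma$-set) if it can be partitioned into two nonempty sets $A_1,A_2$ with $A_1\succ V(G)\setminus A$. Given such a partition and a bijection $\pi:V(G)\to V(G')$, put $B_1'=\pi(A_1)$, $B_2'=\pi(A_2)$, $B'=\pi(A)$. The separable $\gamma$-set $A=A_1\cup A_2$ is effective under $\pi$ if $B'$ is a $B_2'$-$\gamma$-set of $G'$, i.e. $B'$ is a $\gamma$-set of $G'$ partitioned into the nonempty sets $B_1',B_2'$ with $B_2'\succ V(G')\setminus B'$. A non-isolated vertex is $C_3$-free if it belongs to no triangle of $G$. *)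

theory Defs
  imports Main
begin

definition simple_graph :: "'a set \<Rightarrow> ('a \<Rightarrow> 'a \<Rightarrow> bool) \<Rightarrow> bool" where
  "simple_graph V E \<longleftrightarrow> finite V \<and> (\<forall>u v. E u v \<longrightarrow> u \<in> V \<and> v \<in> V)
     \<and> (\<forall>u v. E u v \<longrightarrow> E v u) \<and> (\<forall>v. \<not> E v v)"

definition dominates :: "('a \<Rightarrow> 'a \<Rightarrow> bool) \<Rightarrow> 'a set \<Rightarrow> 'a set \<Rightarrow> bool" where
  "dominates E D S \<longleftrightarrow> (\<forall>s\<in>S. \<exists>d\<in>D. E d s)"

definition dominating_set :: "'a set \<Rightarrow> ('a \<Rightarrow> 'a \<Rightarrow> bool) \<Rightarrow> 'a set \<Rightarrow> bool" where
  "dominating_set V E D \<longleftrightarrow> D \<subseteq> V \<and> dominates E D (V - D)"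

definition domination_number :: "'a set \<Rightarrow> ('a \<Rightarrow> 'a \<Rightarrow> bool) \<Rightarrow> nat" where
  "domination_number V E = Min (card ` {D. dominating_set V E D})"

definition gamma_set :: "'a set \<Rightarrow> ('a \<Rightarrow> 'a \<Rightarrow> bool) \<Rightarrow> 'a set \<Rightarrow> bool" where
  "gamma_set V E D \<longleftrightarrow> dominating_set V E D \<and> card D = domination_number V E"

definition separable_partition ::
  "'a set \<Rightarrow> ('a \<Rightarrow> 'a \<Rightarrow> bool) \<Rightarrow> 'a set \<Rightarrow> 'a set \<Rightarrow> 'a set \<Rightarrow> bool" where
  "separable_partition V E A A1 A2 \<longleftrightarrow> gamma_set V E A \<and> A = A1 \<union> A2 \<and> A1 \<inter> A2 = {}
     \<and> A1 \<noteq> {} \<and> A2 \<noteq> {} \<and> dominates E A1 (V - A)"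

definition effective_under ::
  "'b set \<Rightarrow> ('b \<Rightarrow> 'b \<Rightarrow> bool) \<Rightarrow> ('a \<Rightarrow> 'b) \<Rightarrow> 'a set \<Rightarrow> 'a set \<Rightarrow> 'a set \<Rightarrow> bool" where
  "effective_under V' E' \<pi> A A1 A2 \<longleftrightarrow>
     gamma_set V' E' (\<pi> ` A) \<and> \<pi> ` A = \<pi> ` A1 \<union> \<pi> ` A2 \<and> \<pi> ` A1 \<inter> \<pi> ` A2 = {}
     \<and> \<pi> ` A1 \<noteq> {} \<and> \<pi> ` A2 \<noteq> {} \<and> dominates E' (\<pi> ` A2) (V' - \<pi> ` A)"

definition C3_free_vertex :: "('a \<Rightarrow> 'a \<Rightarrow> bool) \<Rightarrow> 'a \<Rightarrow> bool" where
  "C3_free_vertex E x \<longleftrightarrow> (\<exists>y. E x y) \<and> \<not> (\<exists>y z. E x y \<and> E x z \<and> E y z)"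

definition closed_nbhd :: "'a set \<Rightarrow> ('a \<Rightarrow> 'a \<Rightarrow> bool) \<Rightarrow> 'a \<Rightarrow> 'a set" where
  "closed_nbhd V E x = insert x {v \<in> V. E x v}"

(* G' = (V',E') is a copy of G = (V,E) via the isomorphism c (c v = v') *)
definition graph_copy ::
  "'a set \<Rightarrow> ('a \<Rightarrow> 'a \<Rightarrow> bool) \<Rightarrow> 'b set \<Rightarrow> ('b \<Rightarrow> 'b \<Rightarrow> bool) \<Rightarrow> ('a \<Rightarrow> 'b) \<Rightarrow> bool" where
  "graph_copy V E V' E' c \<longleftrightarrow> bij_betw c V V'
     \<and> (\<forall>u v. E' u v \<longrightarrow> u \<in> V' \<and> v \<in> V')
     \<and> (\<forall>u\<in>V. \<forall>v\<in>V. E' (c u) (c v) \<longleftrightarrow> E u v)"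

end

theory Submission
  imports Defs
begin

text \<open>
  In an \<open>A\<^sub>1\<close>-\<open>\<gamma>\<close>-set no vertex of \<open>A\<^sub>2\<close> has a neighbour in \<open>A\<close> (otherwise it could be
  dropped), and \<open>A\<^sub>2\<close> meets every closed neighbourhood at most once (otherwise that part could be
  replaced by the centre). Effectiveness says the same of \<open>\<pi>(A)\<close> with the roles of the two parts
  exchanged. Since \<open>\<pi>\<close> permutes the copy of the star \<open>X = N[x]\<close> without fixed points, chasing
  who dominates the copy \<open>x'\<close> of the centre rules out \<open>x \<in> A\<close>, and for \<open>x \<notin> A\<close> forces
  \<open>A \<inter> X = {y, u}\<close> with \<open>\<pi>(y) = u'\<close> and \<open>\<pi>(u) = y'\<close>, which condition (iii) forbids.
\<close>

lemma gamma_set_card_le: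
  assumes "finite V" "gamma_set V E A" "dominating_set V E D"
  shows "card A \<le> card D"
proof -
  have "finite {D. dominating_set V E D}"
    by (rule finite_subset[of _ "Pow V"]) (auto simp: dominating_set_def assms(1))
  then have "Min (card ` {D. dominating_set V E D}) \<le> card D"
    using assms(3) by (intro Min_le) auto
  then show ?thesis
    using assms(2) by (simp add: gamma_set_def domination_number_def)
qed

lemma graph_copy_simple_graph:
  assumes G: "simple_graph V E" and copy: "graph_copy V E V' E' c"
  shows "simple_graph V' E'"
proof -
  have img: "c ` V = V'" and E'V: "\<And>u v. E' u v \<Longrightarrow> u \<in> V' \<and> v \<in> V'"
    and adj: "\<And>u v. u \<in> V \<Longrightarrow> v \<in> V \<Longrightarrow> E' (c u) (c v) \<longleftrightarrow> E u v"
    using copy by (auto simp: graph_copy_def bij_betw_def)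
  have "E' v u \<and> u \<noteq> v" if "E' u v" for u v
  proof -
    obtain a b where "a \<in> V" "b \<in> V" "u = c a" "v = c b"
      using E'V[OF \<open>E' u v\<close>] img by blast
    then have "E a b"
      using that adj by simp
    then have "E' v u"
      using adj G \<open>a \<in> V\<close> \<open>b \<in> V\<close> \<open>u = c a\<close> \<open>v = c b\<close> by (simp add: simple_graph_def)
    moreover have "u \<noteq> v"
      using \<open>E a b\<close> \<open>E' u v\<close> adj G \<open>a \<in> V\<close> \<open>u = c a\<close> by (auto simp: simple_graph_def)
    ultimately show ?thesis ..
  qed
  then show ?thesis
    using G img E'V by (auto simp: simple_graph_def)
qed

lemma graph_copy_closed_nbhd:
  assumes copy: "graph_copy V E V' E' c" and "x \<in> V"
  shows "closed_nbhd V' E' (c x) = c ` closed_nbhd V E x"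
proof -
  have img: "c ` V = V'"
    and adj: "\<And>u v. u \<in> V \<Longrightarrow> v \<in> V \<Longrightarrow> E' (c u) (c v) \<longleftrightarrow> E u v"
    using copy by (auto simp: graph_copy_def bij_betw_def)
  show ?thesis
    using assms(2) by (auto simp: closed_nbhd_def adj simp flip: img)
qed

lemma effective_under_iff_separable_partition:
  "effective_under V' E' \<pi> A A1 A2 \<longleftrightarrow> separable_partition V' E' (\<pi> ` A) (\<pi> ` A2) (\<pi> ` A1)"
  by (auto simp: effective_under_def separable_partition_def)

lemma separable_partition_no_edge_into_second_part:
  assumes G: "simple_graph V E" and sep: "separable_partition V E A A1 A2"
    and "a \<in> A2" "b \<in> A"
  shows "\<not> E b a"
proof
  assume "E b a"
  have A: "gamma_set V E A" "A \<subseteq> V" "finite A" "a \<in> A" "a \<notin> A1"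
    and dom: "dominates E A1 (V - A)" and "A1 \<subseteq> A"
    using sep G assms(3) finite_subset
    by (auto simp: separable_partition_def gamma_set_def dominating_set_def simple_graph_def)
  have "b \<noteq> a"
    using \<open>E b a\<close> G by (auto simp: simple_graph_def)
  have "dominating_set V E (A - {a})"
    unfolding dominating_set_def dominates_def
  proof (intro conjI ballI)
    show "A - {a} \<subseteq> V"
      using A(2) by blast
    fix s assume s: "s \<in> V - (A - {a})"
    show "\<exists>d\<in>A - {a}. E d s"
    proof (cases "s = a")
      case True
      then show ?thesis
        using \<open>b \<noteq> a\<close> \<open>b \<in> A\<close> \<open>E b a\<close> by blast
    next
      case False
      then obtain d where "d \<in> A1" "E d s"
        using dom s by (auto simp: dominates_def)
      then show ?thesis
        using \<open>A1 \<subseteq> A\<close> A(5) by blast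
    qed
  qed
  then have "card A \<le> card (A - {a})"
    using gamma_set_card_le G A(1) by (auto simp: simple_graph_def)
  then show False
    using card_Diff1_less[OF A(3,4)] by simp
qed

lemma separable_partition_second_part_closed_nbhd:
  assumes G: "simple_graph V E" and sep: "separable_partition V E A A1 A2" and "x \<in> V"
    and "a \<in> A2 \<inter> closed_nbhd V E x" "b \<in> A2 \<inter> closed_nbhd V E x"
  shows "a = b"
proof -
  let ?N = "closed_nbhd V E x"
  have finV: "finite V" and gA: "gamma_set V E A" and A: "A = A1 \<union> A2" "A1 \<inter> A2 = {}"
    and AV: "A \<subseteq> V" and dom: "dominates E A1 (V - A)"
    using G sep by (auto simp: simple_graph_def separable_partition_def gamma_set_def dominating_set_def)
  have fin: "finite A1" "finite A2"
    using A AV finV finite_subset by auto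
  have "dominating_set V E (A1 \<union> (A2 - ?N) \<union> {x})"
    using dom AV A \<open>x \<in> V\<close>
    by (auto simp: dominating_set_def dominates_def closed_nbhd_def)
  then have "card A \<le> card (A1 \<union> (A2 - ?N) \<union> {x})"
    using gamma_set_card_le[OF finV gA] by blast
  also have "\<dots> \<le> card A1 + card (A2 - ?N) + 1"
    using card_Un_le[of "A1 \<union> (A2 - ?N)" "{x}"] card_Un_le[of A1 "A2 - ?N"] by simp
  finally have "card A1 + card A2 \<le> card A1 + card (A2 - ?N) + 1"
    using A fin by (simp add: card_Un_disjoint)
  then have "card (A2 \<inter> ?N) \<le> Suc 0"
    using card_Int_Diff[OF fin(2), of ?N] by simp
  then have "\<forall>p\<in>A2 \<inter> ?N. \<forall>q\<in>A2 \<inter> ?N. p = q"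
    using card_le_Suc0_iff_eq[of "A2 \<inter> ?N"] fin(2) by simp
  then show ?thesis
    using assms(4,5) by blast
qed

locale star_relabelling =
  fixes V :: "'a set" and E :: "'a \<Rightarrow> 'a \<Rightarrow> bool"
    and V' :: "'b set" and E' :: "'b \<Rightarrow> 'b \<Rightarrow> bool"
    and c :: "'a \<Rightarrow> 'b" and \<pi> :: "'a \<Rightarrow> 'b" and x :: 'a
  assumes G: "simple_graph V E"
    and copy: "graph_copy V E V' E' c"
    and x_in_V: "x \<in> V"
    and x_free: "C3_free_vertex E x"
    and pi_bij: "bij_betw \<pi> V V'"
    and pi_outside: "\<And>v. v \<in> V - closed_nbhd V E x \<Longrightarrow> \<pi> v = c v"
    and pi_inside: "\<And>v. v \<in> closed_nbhd V E x \<Longrightarrow> \<pi> v \<noteq> c v"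
begin

abbreviation X :: "'a set" where "X \<equiv> closed_nbhd V E x"

lemma G': "simple_graph V' E'"
  using graph_copy_simple_graph[OF G copy] .

lemma copy_adj: "u \<in> V \<Longrightarrow> v \<in> V \<Longrightarrow> E' (c u) (c v) \<longleftrightarrow> E u v"
  using copy by (simp add: graph_copy_def)

lemma E_sym: "E u v \<Longrightarrow> E v u" and E_in_V: "E u v \<Longrightarrow> u \<in> V \<and> v \<in> V"
  and E_irrefl: "\<not> E v v"
  using G by (auto simp: simple_graph_def)

lemma mem_X: "v \<in> X \<longleftrightarrow> v = x \<or> (v \<in> V \<and> E x v)"
  by (auto simp: closed_nbhd_def)

lemma X_subset: "X \<subseteq> V"
  using x_in_V by (auto simp: mem_X)

lemma leaf_adj: "v \<in> X \<Longrightarrow> v \<noteq> x \<Longrightarrow> E x v"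
  by (simp add: mem_X)

lemma nbr_in_X: "E v x \<Longrightarrow> v \<in> X"
  using E_sym E_in_V by (auto simp: mem_X)

lemma leaves_not_adj: "E x a \<Longrightarrow> E x b \<Longrightarrow> \<not> E a b"
  using x_free by (auto simp: C3_free_vertex_def)

lemma c_inj: "u \<in> V \<Longrightarrow> v \<in> V \<Longrightarrow> c u = c v \<Longrightarrow> u = v"
  using copy by (auto simp: graph_copy_def bij_betw_def dest: inj_onD)

lemma pi_inj: "u \<in> V \<Longrightarrow> v \<in> V \<Longrightarrow> \<pi> u = \<pi> v \<Longrightarrow> u = v"
  using pi_bij by (auto simp: bij_betw_def dest: inj_onD)

text \<open>Since \<open>\<pi>\<close> agrees with \<open>c\<close> off \<open>X\<close>, it maps \<open>X\<close> onto the copy of \<open>X\<close>.\<close>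

lemma pi_X_copy:
  assumes "v \<in> X" obtains w where "w \<in> X" "\<pi> v = c w"
proof -
  have "\<pi> v \<in> c ` V"
    using pi_bij copy assms X_subset by (auto simp: bij_betw_def graph_copy_def)
  then obtain w where w: "w \<in> V" "\<pi> v = c w" by blast
  have "w \<in> X"
  proof (rule ccontr)
    assume "w \<notin> X"
    then have "\<pi> w = \<pi> v"
      using w pi_outside by simp
    then show False
      using pi_inj w(1) assms X_subset \<open>w \<notin> X\<close> by blast
  qed
  then show thesis
    using that w(2) by blast
qed

lemma pi_eq_copy_of_X:
  assumes "v \<in> V" "w \<in> X" "\<pi> v = c w" shows "v \<in> X"
proof (rule ccontr)
  assume "v \<notin> X"
  then have "c v = c w"
    using pi_outside assms(1,3) by simp
  then show False
    using c_inj assms(1,2) X_subset \<open>v \<notin> X\<close> by blast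
qed

lemma pi_adj_copy_x:
  assumes "a \<in> V" "E' (\<pi> a) (c x)" shows "a \<in> X"
proof (rule ccontr)
  assume "a \<notin> X"
  then have "E a x"
    using pi_outside copy_adj x_in_V assms by simp
  then show False
    using nbr_in_X \<open>a \<notin> X\<close> by blast
qed

end

locale effective_separable_set = star_relabelling +
  fixes A A1 A2 :: "'a set"
  assumes sep: "separable_partition V E A A1 A2"
    and eff: "effective_under V' E' \<pi> A A1 A2"
begin

lemma A_parts: "A = A1 \<union> A2" "A1 \<inter> A2 = {}" and A_subset: "A \<subseteq> V"
  using sep by (auto simp: separable_partition_def gamma_set_def dominating_set_def)

lemma image_parts_disjoint: "\<pi> ` A1 \<inter> \<pi> ` A2 = {}"
  using eff by (simp add: effective_under_def)

lemma dominated_by_A1: "v \<in> V \<Longrightarrow> v \<notin> A \<Longrightarrow> \<exists>d\<in>A1. E d v"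
  using sep by (auto simp: separable_partition_def dominates_def)

lemma dominated_by_image_A2: "v \<in> V' \<Longrightarrow> v \<notin> \<pi> ` A \<Longrightarrow> \<exists>d\<in>A2. E' (\<pi> d) v"
  using eff by (auto simp: effective_under_def dominates_def)

lemma no_edge_into_A2: "a \<in> A2 \<Longrightarrow> b \<in> A \<Longrightarrow> \<not> E b a"
  using separable_partition_no_edge_into_second_part[OF G sep] .

lemma no_edge_into_image_A1: "a \<in> A1 \<Longrightarrow> b \<in> \<pi> ` A \<Longrightarrow> \<not> E' b (\<pi> a)"
  using separable_partition_no_edge_into_second_part[OF G' eff[unfolded effective_under_iff_separable_partition]]
  by blast

lemma copy_x_dominator:
  assumes "c x \<notin> \<pi> ` A" obtains u where "u \<in> A2" "u \<in> X" "E' (\<pi> u) (c x)"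
proof -
  have "c x \<in> V'"
    using copy x_in_V by (auto simp: graph_copy_def bij_betw_def)
  then obtain u where "u \<in> A2" "E' (\<pi> u) (c x)"
    using dominated_by_image_A2 assms by blast
  moreover have "u \<in> V"
    using \<open>u \<in> A2\<close> A_parts A_subset by blast
  ultimately show thesis
    using that pi_adj_copy_x by blast
qed

text \<open>
  The dominator in \<open>\<pi>(A\<^sub>2)\<close> of the copy of a leaf in \<open>A\<close> is neither outside \<open>X\<close> (it would be a
  neighbour of that leaf in \<open>A\<^sub>2\<close>) nor the copy of another leaf (no triangles), so it is \<open>x'\<close>.
\<close>

lemma copy_of_leaf_dominator:
  assumes "l \<in> A" "E x l" "c l \<notin> \<pi> ` A"
  shows "c x \<in> \<pi> ` A2"
proof -
  have "l \<in> V"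
    using assms(1) A_subset by blast
  then have "c l \<in> V'"
    using copy by (auto simp: graph_copy_def bij_betw_def)
  then obtain a where a: "a \<in> A2" "E' (\<pi> a) (c l)"
    using dominated_by_image_A2 assms(3) by blast
  have "a \<in> V"
    using a(1) A_parts A_subset by blast
  show ?thesis
  proof (cases "a \<in> X")
    case False
    then have "E a l"
      using a(2) pi_outside copy_adj \<open>a \<in> V\<close> \<open>l \<in> V\<close> by simp
    then show ?thesis
      using no_edge_into_A2 a(1) assms(1) E_sym by blast
  next
    case True
    then obtain w where w: "w \<in> X" "\<pi> a = c w"
      by (rule pi_X_copy)
    then have "E w l"
      using a(2) copy_adj X_subset \<open>l \<in> V\<close> by auto
    then have "w = x"
      using leaf_adj[OF w(1)] leaves_not_adj assms(2) by blast
    then show ?thesis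
      using w(2) a(1) by (metis imageI)
  qed
qed

lemma x_not_in_A2: "x \<notin> A2"
proof
  assume "x \<in> A2"
  then have A_X: "a \<in> A \<Longrightarrow> a \<in> X \<Longrightarrow> a = x" for a
    using no_edge_into_A2 leaf_adj E_sym by metis
  obtain y where y: "y \<in> X" "\<pi> x = c y"
    using pi_X_copy mem_X by blast
  have "y \<notin> A"
    using A_X y pi_inside mem_X by fastforce
  moreover have "y \<in> V"
    using y(1) X_subset by blast
  ultimately obtain a where a: "a \<in> A1" "E a y"
    using dominated_by_A1 by blast
  have "a \<in> V" "a \<notin> X"
    using a(1) A_X A_parts A_subset \<open>x \<in> A2\<close> by blast+
  then have "E' (\<pi> x) (\<pi> a)"
    using y(2) E_sym[OF a(2)] pi_outside copy_adj \<open>y \<in> V\<close> by simp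
  moreover have "\<pi> x \<in> \<pi> ` A"
    using \<open>x \<in> A2\<close> A_parts by blast
  ultimately show False
    using no_edge_into_image_A1 a(1) by blast
qed

lemma x_not_in_A1: "x \<notin> A1"
proof
  assume "x \<in> A1"
  obtain y where y: "y \<in> X" "\<pi> x = c y"
    using pi_X_copy mem_X by blast
  have "E x y"
    using y pi_inside mem_X leaf_adj by fastforce
  have "c x \<notin> \<pi> ` A"
  proof
    assume "c x \<in> \<pi> ` A"
    moreover have "E' (c x) (\<pi> x)"
      using y \<open>E x y\<close> copy_adj E_in_V by simp
    ultimately show False
      using no_edge_into_image_A1 \<open>x \<in> A1\<close> by blast
  qed
  then obtain u where "u \<in> A2" "u \<in> X"
    by (rule copy_x_dominator)
  moreover have "u \<noteq> x"
    using \<open>u \<in> A2\<close> \<open>x \<in> A1\<close> A_parts by blast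
  ultimately show False
    using leaf_adj no_edge_into_A2 \<open>x \<in> A1\<close> A_parts by blast
qed

lemma x_not_in_A: "x \<notin> A"
  using x_not_in_A1 x_not_in_A2 A_parts by blast

lemma dominator_of_x: obtains y where "y \<in> A1" "y \<in> X" "E x y"
  using dominated_by_A1[OF x_in_V x_not_in_A] nbr_in_X E_sym by blast

lemma copy_x_not_in_image: "c x \<notin> \<pi> ` A"
proof
  assume "c x \<in> \<pi> ` A"
  then obtain w where w: "w \<in> A" "\<pi> w = c x"
    by (metis imageE)
  obtain y where y: "y \<in> A1" "y \<in> X" "E x y"
    by (rule dominator_of_x)
  consider "w \<in> A1" | "w \<in> A2"
    using w(1) A_parts by blast
  then show False
  proof cases
    case 1
    have "c y \<notin> \<pi> ` A"
    proof
      assume "c y \<in> \<pi> ` A"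
      moreover have "E' (c y) (\<pi> w)"
        using w(2) E_sym[OF y(3)] copy_adj E_in_V[OF y(3)] by simp
      ultimately show False
        using no_edge_into_image_A1 1 by blast
    qed
    then have "c x \<in> \<pi> ` A2"
      using copy_of_leaf_dominator y(1,3) A_parts by blast
    moreover have "c x \<in> \<pi> ` A1"
      using w(2) 1 by (metis imageI)
    ultimately show False
      using image_parts_disjoint by blast
  next
    case 2
    obtain z where z: "z \<in> X" "\<pi> y = c z"
      using pi_X_copy y(2) by blast
    have "z \<noteq> x"
    proof
      assume "z = x"
      moreover have "y \<in> V" "w \<in> V"
        using y(1) w(1) A_parts A_subset by blast+
      ultimately have "y = w"
        using pi_inj z(2) w(2) by metis
      then show False
        using y(1) 2 A_parts by blast
    qed
    then have "E' (\<pi> w) (\<pi> y)"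
      using w(2) z leaf_adj copy_adj x_in_V X_subset by auto
    then show False
      using no_edge_into_image_A1 y(1) w(1) by blast
  qed
qed

lemma A2_meets_X_once: "a \<in> A2 \<Longrightarrow> a \<in> X \<Longrightarrow> b \<in> A2 \<Longrightarrow> b \<in> X \<Longrightarrow> a = b"
  using separable_partition_second_part_closed_nbhd[OF G sep x_in_V] by blast

lemma A1_meets_X_once:
  assumes "a \<in> A1" "a \<in> X" "b \<in> A1" "b \<in> X" shows "a = b"
proof -
  have "\<pi> v \<in> closed_nbhd V' E' (c x)" if "v \<in> X" for v
    using pi_X_copy[OF that] graph_copy_closed_nbhd[OF copy x_in_V] by (metis imageI)
  moreover have "c x \<in> V'"
    using copy x_in_V by (auto simp: graph_copy_def bij_betw_def)
  ultimately have "\<pi> a = \<pi> b"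
    using separable_partition_second_part_closed_nbhd[OF G'
        eff[unfolded effective_under_iff_separable_partition], of "c x" "\<pi> a" "\<pi> b"] assms
    by blast
  then show "a = b"
    using pi_inj assms(1,3) A_parts A_subset by blast
qed

lemma copy_of_leaf_preimage:
  assumes "l \<in> A" "E x l" obtains w where "w \<in> A" "w \<in> X" "w \<noteq> l" "\<pi> w = c l"
proof -
  have "c l \<in> \<pi> ` A"
    using copy_of_leaf_dominator[OF assms] copy_x_not_in_image A_parts by blast
  then obtain w where w: "w \<in> A" "\<pi> w = c l"
    by (metis imageE)
  moreover have "l \<in> X"
    using assms(2) E_in_V mem_X by blast
  ultimately show thesis
    using that pi_eq_copy_of_X pi_inside A_subset by blast
qed

text \<open>
  \<open>A\<^sub>1\<close> and \<open>A\<^sub>2\<close> each meet \<open>X\<close> exactly once, in leaves \<open>y\<close> and \<open>u\<close>, and \<open>\<pi>\<close> sends \<open>A \<inter> X\<close>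
  without fixed points onto the copies \<open>y'\<close>, \<open>u'\<close>, so it swaps them.
\<close>

lemma swapped_leaves:
  obtains y u where "y \<in> X" "u \<in> X" "y \<noteq> x" "u \<noteq> x" "y \<noteq> u" "\<pi> y = c u" "\<pi> u = c y"
proof -
  obtain y where y: "y \<in> A1" "y \<in> X" "E x y"
    by (rule dominator_of_x)
  obtain u where u: "u \<in> A2" "u \<in> X"
    using copy_x_dominator[OF copy_x_not_in_image] by blast
  have "y \<noteq> x" "u \<noteq> x" "y \<noteq> u"
    using y(3) E_irrefl u(1) x_not_in_A y(1) A_parts by blast+
  then have "E x u"
    using u(2) leaf_adj by blast
  have A_X: "a = y \<or> a = u" if "a \<in> A" "a \<in> X" for a
    using that A1_meets_X_once A2_meets_X_once y u A_parts by blast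
  obtain w where "w \<in> A" "w \<in> X" "w \<noteq> y" "\<pi> w = c y"
    using copy_of_leaf_preimage y(1,3) A_parts by blast
  then have "\<pi> u = c y"
    using A_X by blast
  obtain w' where "w' \<in> A" "w' \<in> X" "w' \<noteq> u" "\<pi> w' = c u"
    using copy_of_leaf_preimage u(1) \<open>E x u\<close> A_parts by blast
  then have "\<pi> y = c u"
    using A_X by blast
  show thesis
    using that y(2) u(2) \<open>y \<noteq> x\<close> \<open>u \<noteq> x\<close> \<open>y \<noteq> u\<close> \<open>\<pi> y = c u\<close> \<open>\<pi> u = c y\<close> .
qed

end

theorem mainTheorem2:
  fixes V :: "'a set" and E :: "'a \<Rightarrow> 'a \<Rightarrow> bool"
    and V' :: "'b set" and E' :: "'b \<Rightarrow> 'b \<Rightarrow> bool"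
    and c :: "'a \<Rightarrow> 'b" and \<pi> :: "'a \<Rightarrow> 'b" and x :: 'a
  assumes G: "simple_graph V E"
    and copy: "graph_copy V E V' E' c"
    and xV: "x \<in> V"
    and x_free: "C3_free_vertex E x"
    and pi_bij: "bij_betw \<pi> V V'"
    and i: "\<forall>v \<in> V - closed_nbhd V E x. \<pi> v = c v"
    and ii: "\<forall>v \<in> closed_nbhd V E x. \<pi> v \<noteq> c v"
    and iii: "card (closed_nbhd V E x) - 1 \<ge> 2 \<longrightarrow>
              (\<forall>u \<in> closed_nbhd V E x. \<forall>v \<in> closed_nbhd V E x. \<pi> v = c u \<longrightarrow> \<pi> u \<noteq> c v)"
  shows "\<not> (\<exists>A A1 A2. separable_partition V E A A1 A2 \<and> effective_under V' E' \<pi> A A1 A2)"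
proof
  assume "\<exists>A A1 A2. separable_partition V E A A1 A2 \<and> effective_under V' E' \<pi> A A1 A2"
  then obtain A A1 A2 where "separable_partition V E A A1 A2" "effective_under V' E' \<pi> A A1 A2"
    by blast
  then interpret effective_separable_set V E V' E' c \<pi> x A A1 A2
    using assms by unfold_locales auto
  obtain y u where yu: "y \<in> X" "u \<in> X" "y \<noteq> x" "u \<noteq> x" "y \<noteq> u" "\<pi> y = c u" "\<pi> u = c y"
    by (rule swapped_leaves)
  have "finite X"
    using X_subset G finite_subset by (auto simp: simple_graph_def)
  then have "card {x, y, u} \<le> card X"
    using yu(1,2) x_in_V by (intro card_mono) (auto simp: closed_nbhd_def)
  then have "card X - 1 \<ge> 2"
    using yu(3-5) by auto
  then show False
    using iii yu(1,2,6,7) by blast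
qed

end
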